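(* Let $n\ge 1$ be an integer and let $\rho$ be a $2^n\times 2^n$ density matrix with coefficient vector $\vec{\rho}=(\rho_{\mathbf b})_{\mathbf b\in\mathcal M^n}\in\mathbb R^{4^n}$ in the $n$-qubit Pauli basis, and let $\mathbf p=(p_{(\mathbf r,\mathbf a)})_{(\mathbf r,\mathbf a)\in\mathcal R^n\times\mathcal E^n}\in\mathbb R^{6^n}$ be the associated vector of outcome probabilities $p_{(\mathbf r,\mathbf a)}=\mathrm{Tr}(\rho\cdot P^{\mathbf a}_{\mathbf r})$. Let $\mathbf P=[P_{(\mathbf r,\mathbf a),\mathbf b}]$ be the real $6^n\times 4^n$ matrix with entries $$P_{(\mathbf r,\mathbf a),\mathbf b}=\prod_{j\notin E_{\mathbf b}} r_j\,\mathbf I(a_j=b_j).$$ Then $\mathbf P^T\mathbf P$ is a diagonal matrix with non-zero diagonal coefficients given, for all $\mathbf b\in\mathcal M^n$, by $$(\mathbf P^T\mathbf P)_{\mathbf b,\mathbf b}=3^{d(\mathbf b)}\,2^n .$$ As a consequence, the linear operator $\mathbb R^{4^n}\to\mathbb R^{6^n}$, $\vec v\mapsto \mathbf P\vec v$, is invertible onto its range (i.e. injective), and the equation $\mathbf P\vec{\rho}=\mathbf p$ (in the unknown $\vec\rho\in\mathbb R^{4^n}$) has a unique solution, given by $$\vec{\rho}=(\mathbf P^T\mathbf P)^{-1}\mathbf P^T\mathbf p .$$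
   Context: A $2^n\times 2^n$ density matrix is a complex Hermitian positive semidefinite matrix $\rho$ with $\mathrm{Tr}(\rho)=1$. Let $\sigma_x,\sigma_y,\sigma_z$ be the $2\times2$ Pauli matrices and $\sigma_I=I$ the $2\times 2$ identity. Put $\mathcal E^n=\{x,y,z\}^n$, $\mathcal R^n=\{-1,1\}^n$, $\mathcal M^n=\{I,x,y,z\}^n$. For $\mathbf b=(b_1,\dots,b_n)\in\mathcal M^n$ set $\sigma_{\mathbf b}=\sigma_{b_1}\otimes\cdots\otimes\sigma_{b_n}$, $E_{\mathbf b}=\{j\in\{1,\dots,n\}: b_j=I\}$, and let $d(\mathbf b)$ be the cardinality of $E_{\mathbf b}$. Every density matrix has a unique decomposition $\rho=\sum_{\mathbf b\in\mathcal M^n}\rho_{\mathbf b}\sigma_{\mathbf b}$ with real $\rho_{\mathbf b}$ (and $\rho_{(I,\dots,I)}=2^{-n}$). For $a\in\{x,y,z\}$ and $r\in\{-1,1\}$, $P^a_r$ is the orthogonal projector onto the eigenspace of $\sigma_a$ associated with the eigenvalue $r$; for $\mathbf a\in\mathcal E^n$, $\mathbf r\in\mathcal R^n$, $P^{\mathbf a}_{\mathbf r}=P^{a_1}_{r_1}\otimes\cdots\otimes P^{a_n}_{r_n}$. $\mathbf I(\cdot)$ denotes the indicator ($1$ if the condition holds, $0$ otherwise); empty products equal $1$. *)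

theory Defs
  imports "HOL-Analysis.Analysis"
begin

datatype axis = AX | AY | AZ

datatype outcome = R_minus | R_plus

lemma UNIV_axis: "(UNIV :: axis set) = {AX, AY, AZ}"
  using axis.exhaust by blast

lemma UNIV_outcome: "(UNIV :: outcome set) = {R_minus, R_plus}"
  using outcome.exhaust by blast

instance axis :: finite
  by standard (simp add: UNIV_axis)

instance outcome :: finite
  by standard (simp add: UNIV_outcome)

primrec outcome_val :: "outcome \<Rightarrow> real" where
  "outcome_val R_minus = - 1"
| "outcome_val R_plus = 1"

text \<open>
  Qubits are labelled by a finite type \<open>'n\<close>, so that the number of qubits is \<open>CARD('n)\<close>, which
  is automatically at least 1. The elements of \<open>2\<close> label the standard basis of one qubit and those
  of \<open>'n \<Rightarrow> 2\<close> the standard basis of the register. The elements of \<open>'n \<Rightarrow> axis\<close>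
  are the measurement settings (triples x, y, z), those of \<open>'n \<Rightarrow> outcome\<close> the outcome vectors with
  entries -1 and 1, and those of \<open>'n \<Rightarrow> axis option\<close> the Pauli indices, where \<open>None\<close> stands for I.
\<close>

type_synonym 'n operator = "complex ^ ('n \<Rightarrow> 2) ^ ('n \<Rightarrow> 2)"

primrec pauli_axis :: "axis \<Rightarrow> complex ^ 2 ^ 2" where
  "pauli_axis AX = vector [vector [0, 1], vector [1, 0]]"
| "pauli_axis AY = vector [vector [0, - \<i>], vector [\<i>, 0]]"
| "pauli_axis AZ = vector [vector [1, 0], vector [0, - 1]]"

primrec pauli :: "axis option \<Rightarrow> complex ^ 2 ^ 2" where
  "pauli None = mat 1"
| "pauli (Some a) = pauli_axis a"

text \<open>
  Kronecker product of one 2 by 2 matrix per qubit, with rows and columns labelled by the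
  basis labels of the register instead of their positions in the lexicographic order.
\<close>

definition tensor :: "('n::finite \<Rightarrow> complex ^ 2 ^ 2) \<Rightarrow> 'n operator" where
  "tensor A = (\<chi> s t. \<Prod>j\<in>UNIV. A j $ s j $ t j)"

definition pauli_string :: "('n::finite \<Rightarrow> axis option) \<Rightarrow> 'n operator" where
  "pauli_string b = tensor (\<lambda>j. pauli (b j))"

definition cinner :: "complex ^ 'm \<Rightarrow> complex ^ 'm \<Rightarrow> complex" where
  "cinner u v = (\<Sum>i\<in>UNIV. cnj (u $ i) * v $ i)"

definition hermitian :: "complex ^ 'm ^ 'm \<Rightarrow> bool" where
  "hermitian A \<longleftrightarrow> (\<forall>i j. A $ i $ j = cnj (A $ j $ i))"

definition density_matrix :: "'n::finite operator \<Rightarrow> bool" where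
  "density_matrix \<rho> \<longleftrightarrow>
     hermitian \<rho> \<and> (\<forall>v. cinner v (\<rho> *v v) \<in> \<real> \<and> 0 \<le> Re (cinner v (\<rho> *v v))) \<and> trace \<rho> = 1"

definition eigenspace :: "complex ^ 'm ^ 'm \<Rightarrow> complex \<Rightarrow> (complex ^ 'm) set" where
  "eigenspace A c = {v. A *v v = c *s v}"

definition is_orthogonal_projector :: "complex ^ 'm ^ 'm \<Rightarrow> (complex ^ 'm) set \<Rightarrow> bool" where
  "is_orthogonal_projector Q S \<longleftrightarrow>
     (\<forall>v. Q *v v \<in> S \<and> (\<forall>w\<in>S. cinner w (v - Q *v v) = 0))"

definition orthogonal_projector :: "(complex ^ 'm) set \<Rightarrow> complex ^ 'm ^ 'm" where
  "orthogonal_projector S = (THE Q. is_orthogonal_projector Q S)"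

definition axis_projector :: "outcome \<Rightarrow> axis \<Rightarrow> complex ^ 2 ^ 2" where
  "axis_projector r a =
     orthogonal_projector (eigenspace (pauli_axis a) (complex_of_real (outcome_val r)))"

definition outcome_projector ::
    "('n::finite \<Rightarrow> outcome) \<Rightarrow> ('n \<Rightarrow> axis) \<Rightarrow> 'n operator" where
  "outcome_projector r a = tensor (\<lambda>j. axis_projector (r j) (a j))"

definition pauli_coeffs :: "'n::finite operator \<Rightarrow> real ^ ('n \<Rightarrow> axis option)" where
  "pauli_coeffs \<rho> = (THE c. \<rho> = (\<Sum>b\<in>UNIV. (c $ b) *\<^sub>R pauli_string b))"

definition outcome_probs ::
    "'n::finite operator \<Rightarrow> real ^ (('n \<Rightarrow> outcome) \<times> ('n \<Rightarrow> axis))" where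
  "outcome_probs \<rho> = (\<chi> ra. Re (trace (\<rho> ** outcome_projector (fst ra) (snd ra))))"

definition identity_positions :: "('n \<Rightarrow> axis option) \<Rightarrow> 'n set" where
  "identity_positions b = {j. b j = None}"

definition num_identities :: "('n::finite \<Rightarrow> axis option) \<Rightarrow> nat" where
  "num_identities b = card (identity_positions b)"

definition measurement_matrix ::
    "real ^ ('n::finite \<Rightarrow> axis option) ^ (('n \<Rightarrow> outcome) \<times> ('n \<Rightarrow> axis))" where
  "measurement_matrix =
     (\<chi> ra b. \<Prod>j\<in>- identity_positions b.
        outcome_val (fst ra j) * of_bool (Some (snd ra j) = b j))"

text \<open>
  The definite descriptions denote (\<open>orthogonal_projector\<close> on the eigenspaces used here,
  \<open>pauli_coeffs\<close> on Hermitian matrices), and \<open>Re\<close> in \<open>outcome_probs\<close> discards nothing.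
\<close>

lemma cinner_diff_right: "cinner w (u - v) = cinner w u - cinner w v"
  by (simp add: cinner_def algebra_simps sum_subtractf)

lemma cinner_self_eq_0: "cinner v v = 0 \<Longrightarrow> v = 0"
proof -
  assume a: "cinner v v = 0"
  have "cinner v v = complex_of_real (\<Sum>i\<in>UNIV. (cmod (v $ i))\<^sup>2)"
    by (simp add: cinner_def complex_norm_square mult.commute del: of_real_power)
  with a have "(\<Sum>i\<in>UNIV. (cmod (v $ i))\<^sup>2) = 0"
    by (metis of_real_eq_0_iff)
  then have "\<forall>i. v $ i = 0"
    by (simp add: sum_nonneg_eq_0_iff)
  then show "v = 0"
    by (simp add: vec_eq_iff)
qed

lemma orthogonal_projector_unique:
  assumes diff: "\<And>u v. u \<in> S \<Longrightarrow> v \<in> S \<Longrightarrow> u - v \<in> S"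
    and Q: "is_orthogonal_projector Q S" and R: "is_orthogonal_projector R S"
  shows "Q = R"
proof -
  have "Q *v v = R *v v" for v
  proof -
    let ?d = "Q *v v - R *v v"
    have d: "?d \<in> S"
      using Q R diff by (simp add: is_orthogonal_projector_def)
    have "cinner ?d (v - R *v v) = 0" "cinner ?d (v - Q *v v) = 0"
      using Q R d by (auto simp: is_orthogonal_projector_def)
    then have "cinner ?d ?d = 0"
      by (simp add: cinner_diff_right)
    then show ?thesis
      using cinner_self_eq_0 by fastforce
  qed
  then show ?thesis
    by (simp add: matrix_eq)
qed

lemma orthogonal_projector_eq:
  assumes "is_orthogonal_projector Q (eigenspace A c)"
  shows "orthogonal_projector (eigenspace A c) = Q"
  unfolding orthogonal_projector_def
proof (rule the_equality)
  show "R = Q" if "is_orthogonal_projector R (eigenspace A c)" for R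
  proof (rule orthogonal_projector_unique[OF _ that assms])
    show "u - v \<in> eigenspace A c" if "u \<in> eigenspace A c" "v \<in> eigenspace A c" for u v
      using that by (simp add: eigenspace_def matrix_vector_mult_diff_distrib vector_ssub_ldistrib)
  qed
qed (fact assms)

lemma hermitian_cnj: "hermitian A \<Longrightarrow> cnj (A $ i $ k) = A $ k $ i"
  unfolding hermitian_def by (metis complex_cnj_cnj)

lemma hermitianI: "(\<And>i k. cnj (A $ i $ k) = A $ k $ i) \<Longrightarrow> hermitian A"
  unfolding hermitian_def by metis

lemma hermitian_pauli_axis: "hermitian (pauli_axis a)"
  by (cases a) (auto simp: hermitian_def forall_2)

lemma hermitian_pauli: "hermitian (pauli m)"
  by (cases m) (auto simp: hermitian_pauli_axis, auto simp: hermitian_def mat_def)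

lemma pauli_axis_square: "pauli_axis a ** pauli_axis a = mat 1"
  by (cases a) (simp_all add: vec_eq_iff forall_2 matrix_matrix_mult_def sum_2 mat_def)

lemma hermitian_cinner:
  assumes "hermitian A"
  shows "cinner w (A *v v) = cinner (A *v w) v"
proof -
  have "cinner w (A *v v) = (\<Sum>i\<in>UNIV. \<Sum>k\<in>UNIV. cnj (w $ i) * A $ i $ k * v $ k)"
    by (simp add: cinner_def matrix_vector_mult_def sum_distrib_left mult.assoc)
  also have "\<dots> = (\<Sum>k\<in>UNIV. \<Sum>i\<in>UNIV. cnj (w $ i) * A $ i $ k * v $ k)"
    by (rule sum.swap)
  also have "\<dots> = cinner (A *v w) v"
    by (simp add: cinner_def matrix_vector_mult_def sum_distrib_left sum_distrib_right assms hermitian_cnj mult_ac)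
  finally show ?thesis .
qed

lemma is_orthogonal_projector_axis:
  "is_orthogonal_projector ((1/2) *\<^sub>R (mat 1 + outcome_val r *\<^sub>R pauli_axis a))
     (eigenspace (pauli_axis a) (complex_of_real (outcome_val r)))"
    (is "is_orthogonal_projector ?Q ?S")
proof -
  let ?A = "pauli_axis a" and ?c = "complex_of_real (outcome_val r)"
  have cc: "?c * ?c = 1" and cnj_c: "cnj ?c = ?c"
    by (cases r; simp)+
  have Q: "?Q *v v = (1/2) *s (v + ?c *s (?A *v v))" for v
  proof -
    have "?Q = (\<chi> i j. (1/2) * (mat 1 $ i $ j + ?c * ?A $ i $ j))"
      by (simp add: vec_eq_iff scaleR_conv_of_real[where 'a = complex])
    then have "(?Q *v v) $ i = (1/2) * ((mat 1 *v v) $ i + ?c * (?A *v v) $ i)" for i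
      by (simp add: matrix_vector_mult_def sum_2 algebra_simps)
    then show ?thesis
      by (simp only: vec_eq_iff vector_smult_component vector_add_component
          matrix_vector_mul_lid simp_thms)
  qed
  have AA: "?A *v (?A *v v) = v" for v
    by (simp add: matrix_vector_mul_assoc pauli_axis_square)
  have "?A *v (?Q *v v) = ?c *s (?Q *v v)" for v
  proof -
    have "?A *v (?Q *v v) = (1/2) *s (?A *v v + ?c *s v)"
      unfolding Q by (simp add: matrix_vector_right_distrib vector_scalar_commute AA)
    also have "\<dots> = (1/2) *s ((?c * ?c) *s (?A *v v) + ?c *s v)"
      by (simp add: cc)
    also have "\<dots> = ?c *s (?Q *v v)"
      unfolding Q by (simp add: vec_eq_iff algebra_simps)
    finally show ?thesis .
  qed
  moreover have "cinner w (v - ?Q *v v) = 0" if w: "?A *v w = ?c *s w" for v w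
  proof -
    have "cinner w (?A *v v) = ?c * cinner w v"
      unfolding hermitian_cinner[OF hermitian_pauli_axis] w
      by (simp add: cinner_def sum_distrib_left cnj_c mult_ac)
    moreover have "cinner w (?Q *v v) = (1/2) * (cinner w v + ?c * cinner w (?A *v v))"
      unfolding Q by (simp add: cinner_def sum_2 algebra_simps)
    ultimately have "cinner w (?Q *v v) = (1/2) * (cinner w v + (?c * ?c) * cinner w v)"
      by (simp only: mult.assoc)
    then show ?thesis
      by (simp add: cinner_diff_right cc)
  qed
  ultimately show ?thesis
    by (simp add: is_orthogonal_projector_def eigenspace_def)
qed

lemma axis_projector_eq:
  "axis_projector r a = (1/2) *\<^sub>R (mat 1 + outcome_val r *\<^sub>R pauli_axis a)"
  unfolding axis_projector_def
  by (rule orthogonal_projector_eq) (rule is_orthogonal_projector_axis)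

lemma hermitian_axis_projector: "hermitian (axis_projector r a)"
  by (rule hermitianI)
    (simp add: axis_projector_eq mat_def scaleR_conv_of_real[where 'a = complex]
      hermitian_cnj hermitian_pauli_axis)

lemma hermitian_tensor: "(\<And>j. hermitian (A j)) \<Longrightarrow> hermitian (tensor A)"
  by (rule hermitianI) (simp add: tensor_def hermitian_cnj)

lemma trace_mult_real:
  assumes "hermitian A" "hermitian B"
  shows "complex_of_real (Re (trace (A ** B))) = trace (A ** B)"
proof -
  have "cnj (trace (A ** B)) = (\<Sum>i\<in>UNIV. \<Sum>k\<in>UNIV. cnj (A $ i $ k) * cnj (B $ k $ i))"
    by (simp add: trace_def matrix_matrix_mult_def)
  also have "\<dots> = (\<Sum>i\<in>UNIV. \<Sum>k\<in>UNIV. A $ k $ i * B $ i $ k)"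
    by (simp only: assms hermitian_cnj)
  also have "\<dots> = trace (A ** B)"
    by (subst sum.swap) (simp add: trace_def matrix_matrix_mult_def)
  finally have "trace (A ** B) \<in> \<real>"
    by (simp only: Reals_cnj_iff)
  then show ?thesis
    by (rule of_real_Re)
qed

theorem outcome_probs_eq_trace:
  assumes "density_matrix \<rho>"
  shows "complex_of_real (outcome_probs \<rho> $ (r, a)) = trace (\<rho> ** outcome_projector r a)"
proof -
  have "hermitian (outcome_projector r a)"
    unfolding outcome_projector_def by (intro hermitian_tensor hermitian_axis_projector)
  with assms show ?thesis
    unfolding outcome_probs_def density_matrix_def by (simp add: trace_mult_real)
qed

lemma sum_prod_fun:
  fixes g :: "'n::finite \<Rightarrow> 'b::finite \<Rightarrow> 'c::comm_semiring_1"
  shows "(\<Sum>f\<in>UNIV. \<Prod>j\<in>UNIV. g j (f j)) = (\<Prod>j\<in>UNIV. \<Sum>x\<in>UNIV. g j x)"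
  using prod_sum_PiE[of "UNIV :: 'n set" "\<lambda>_. UNIV :: 'b set" g]
  by (simp add: PiE_UNIV_domain)

lemma UNIV_axis_option: "(UNIV :: axis option set) = {None, Some AX, Some AY, Some AZ}"
  by (simp add: UNIV_option_conv UNIV_axis)

lemma prod_of_bool:
  "(\<Prod>j\<in>(UNIV :: 'n::finite set). (2 :: complex) * of_bool (R j)) = 2 ^ CARD('n) * of_bool (\<forall>j. R j)"
  by (auto simp: prod.distrib)

lemma pauli_completeness:
  "(\<Sum>m\<in>UNIV. pauli m $ s $ t * pauli m $ u $ v) = 2 * of_bool (s = v \<and> t = u)"
proof -
  show ?thesis
    using exhaust_2[of s] exhaust_2[of t] exhaust_2[of u] exhaust_2[of v]
    by (auto simp: UNIV_axis_option mat_def)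
qed

lemma pauli_orthogonality:
  "(\<Sum>s\<in>UNIV. \<Sum>t\<in>UNIV. pauli l $ s $ t * pauli m $ t $ s) = 2 * of_bool (l = m)"
proof -
  have "l \<in> {None, Some AX, Some AY, Some AZ}" "m \<in> {None, Some AX, Some AY, Some AZ}"
    using UNIV_axis_option by auto
  then show ?thesis
    by (auto simp: sum_2 mat_def)
qed

lemma pauli_string_completeness:
  fixes s t u v :: "'n::finite \<Rightarrow> 2"
  shows "(\<Sum>b\<in>UNIV. pauli_string b $ s $ t * pauli_string b $ u $ v) =
    2 ^ CARD('n) * of_bool (s = v \<and> t = u)"
proof -
  have "(\<Sum>b\<in>UNIV. pauli_string b $ s $ t * pauli_string b $ u $ v) =
     (\<Sum>b\<in>UNIV. \<Prod>j\<in>UNIV. pauli (b j) $ s j $ t j * pauli (b j) $ u j $ v j)"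
    by (simp add: pauli_string_def tensor_def prod.distrib)
  also have "\<dots> = (\<Prod>j\<in>UNIV. 2 * of_bool (s j = v j \<and> t j = u j))"
    by (subst sum_prod_fun) (simp add: pauli_completeness)
  finally show ?thesis
    by (simp add: prod_of_bool fun_eq_iff all_conj_distrib)
qed

lemma pauli_string_orthogonality:
  fixes b c :: "'n::finite \<Rightarrow> axis option"
  shows "trace (pauli_string b ** pauli_string c) = 2 ^ CARD('n) * of_bool (b = c)"
proof -
  have "trace (pauli_string b ** pauli_string c) =
     (\<Sum>s\<in>UNIV. \<Sum>t\<in>UNIV. \<Prod>j\<in>UNIV. pauli (b j) $ s j $ t j * pauli (c j) $ t j $ s j)"
    by (simp add: trace_def matrix_matrix_mult_def pauli_string_def tensor_def prod.distrib)
  also have "\<dots> = (\<Prod>j\<in>UNIV. \<Sum>x\<in>UNIV. \<Sum>y\<in>UNIV. pauli (b j) $ x $ y * pauli (c j) $ y $ x)"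
    by (subst sum_prod_fun, subst sum_prod_fun) simp
  finally show ?thesis
    by (simp add: pauli_orthogonality prod_of_bool fun_eq_iff)
qed

theorem pauli_decomposition_unique:
  fixes A :: "'n::finite operator"
  assumes "hermitian A"
  shows "\<exists>!c. A = (\<Sum>b\<in>UNIV. (c $ b) *\<^sub>R pauli_string b)"
proof (rule ex1I)
  let ?c = "\<lambda>b. Re (trace (A ** pauli_string b)) / 2 ^ CARD('n)"
  have herm: "hermitian (pauli_string b)" for b :: "'n \<Rightarrow> axis option"
    unfolding pauli_string_def by (intro hermitian_tensor hermitian_pauli)
  have c: "complex_of_real (?c b) = trace (A ** pauli_string b) / 2 ^ CARD('n)" for b
    using trace_mult_real[OF assms herm[of b]] by simp
  show "A = (\<Sum>b\<in>UNIV. ((\<chi> b. ?c b) $ b) *\<^sub>R pauli_string b)"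
  proof -
    have "(\<Sum>b\<in>UNIV. (?c b) *\<^sub>R pauli_string b) $ s $ t = A $ s $ t" for s t
    proof -
      have "(\<Sum>b\<in>UNIV. (?c b) *\<^sub>R pauli_string b) $ s $ t
          = (\<Sum>b\<in>UNIV. complex_of_real (?c b) * pauli_string b $ s $ t)"
        by (simp add: scaleR_conv_of_real[where 'a = complex])
      also have "\<dots> = (\<Sum>b\<in>UNIV. \<Sum>i\<in>UNIV. \<Sum>k\<in>UNIV.
          A $ i $ k / 2 ^ CARD('n) * (pauli_string b $ k $ i * pauli_string b $ s $ t))"
        unfolding c
        by (simp add: trace_def matrix_matrix_mult_def sum_distrib_left sum_distrib_right sum_divide_distrib mult_ac)
      also have "\<dots> = (\<Sum>i\<in>UNIV. \<Sum>k\<in>UNIV. \<Sum>b\<in>UNIV.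
          A $ i $ k / 2 ^ CARD('n) * (pauli_string b $ k $ i * pauli_string b $ s $ t))"
        by (subst sum.swap, rule sum.cong[OF refl], rule sum.swap)
      also have "\<dots> = (\<Sum>i\<in>UNIV. \<Sum>k\<in>UNIV. A $ i $ k * of_bool (k = t \<and> i = s))"
        by (simp only: sum_distrib_left[symmetric] pauli_string_completeness, intro sum.cong refl) simp
      also have "\<dots> = (\<Sum>i\<in>UNIV. \<Sum>k\<in>UNIV. if k = t then if i = s then A $ i $ k else 0 else 0)"
        by (intro sum.cong) auto
      also have "\<dots> = A $ s $ t"
        by simp
      finally show ?thesis .
    qed
    then show ?thesis
      by (simp add: vec_eq_iff)
  qed
  show "c = (\<chi> b. ?c b)" if "A = (\<Sum>b\<in>UNIV. (c $ b) *\<^sub>R pauli_string b)" for c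
  proof -
    have "complex_of_real (c $ a) = complex_of_real (?c a)" for a
    proof -
      have "trace (A ** pauli_string a) = (\<Sum>s\<in>UNIV. \<Sum>t\<in>UNIV. \<Sum>b\<in>UNIV.
          complex_of_real (c $ b) * (pauli_string b $ s $ t * pauli_string a $ t $ s))"
        by (subst that)
          (simp add: trace_def matrix_matrix_mult_def sum_distrib_left sum_distrib_right scaleR_conv_of_real[where 'a = complex] mult_ac)
      also have "\<dots> = (\<Sum>b\<in>UNIV. \<Sum>s\<in>UNIV. \<Sum>t\<in>UNIV.
          complex_of_real (c $ b) * (pauli_string b $ s $ t * pauli_string a $ t $ s))"
        by (subst sum.swap[where A = "UNIV :: ('n \<Rightarrow> axis option) set"], rule sum.cong[OF refl], rule sum.swap)
      also have "\<dots> = (\<Sum>b\<in>UNIV. complex_of_real (c $ b) * trace (pauli_string b ** pauli_string a))"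
        by (simp add: trace_def matrix_matrix_mult_def sum_distrib_left)
      also have "\<dots> = (\<Sum>b\<in>UNIV. if b = a then complex_of_real (c $ b) * 2 ^ CARD('n) else 0)"
        by (intro sum.cong) (auto simp: pauli_string_orthogonality)
      also have "\<dots> = complex_of_real (c $ a) * 2 ^ CARD('n)"
        by simp
      finally show ?thesis
        unfolding c by simp
    qed
    then show ?thesis
      by (simp add: vec_eq_iff del: of_real_divide)
  qed
qed

end

theory Submission
  imports Defs
begin

text \<open>
  Everything factors over the qubits. The entry of the measurement matrix at an outcome vector, a
  setting and a Pauli index is a product of one-qubit entries (\<open>measurement_matrix_eq_prod\<close>).
  Summing a product of functions of separate coordinates gives the product of the sums, so the
  Gram matrix of the columns is a product of one-qubit Gram matrices, and these are diagonal
  (\<open>qubit_gram\<close>). The diagonal entry is thus 6 per identity and 2 per axis, that is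
  \<open>3\<^sup>d 2\<^sup>n\<close> with \<open>d\<close> identities among \<open>n\<close> qubits.

  That the matrix maps Pauli coefficients to outcome probabilities rests on the same factorization
  on the operator side: the trace of a Pauli string against an outcome projector is the product of
  the one-qubit traces, and each of these is the corresponding one-qubit entry
  (\<open>trace_pauli_axis_projector\<close>). By linearity of the trace, the Pauli expansion of the state gives
  \<open>measurement_matrix_pauli_coeffs\<close>. The remaining claims are least squares: a matrix whose Gram
  matrix is invertible is injective, and multiplying the equation by its transpose
  and then by the inverse Gram matrix recovers the unknown.
\<close>

definition qubit_entry :: "outcome \<Rightarrow> axis \<Rightarrow> axis option \<Rightarrow> real" where
  "qubit_entry r a m = (case m of None \<Rightarrow> 1 | Some c \<Rightarrow> outcome_val r * of_bool (a = c))"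

lemma measurement_matrix_eq_prod:
  "measurement_matrix $ (r, a) $ b = (\<Prod>j\<in>UNIV. qubit_entry (r j) (a j) (b j))"
proof -
  have "(\<Prod>j\<in>UNIV. qubit_entry (r j) (a j) (b j)) =
      (\<Prod>j\<in>- identity_positions b. qubit_entry (r j) (a j) (b j))"
    by (rule prod.mono_neutral_right) (auto simp: identity_positions_def qubit_entry_def)
  also have "\<dots> = (\<Prod>j\<in>- identity_positions b. outcome_val (r j) * of_bool (Some (a j) = b j))"
    by (rule prod.cong) (auto simp: identity_positions_def qubit_entry_def)
  finally show ?thesis
    by (simp add: measurement_matrix_def)
qed

text \<open>
  The column of I consists of six ones, and the column of an axis has nonzero entries only in the
  two rows of that axis, where they are 1 and -1. In the product of the I column with an axis column
  these two cancel, and the columns of two different axes have disjoint supports.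
\<close>

lemma qubit_gram:
  "(\<Sum>r\<in>UNIV. \<Sum>a\<in>UNIV. qubit_entry r a m * qubit_entry r a m') =
    2 * of_bool (m = m') * (if m = None then 3 else 1)"
proof -
  have "m \<in> {None, Some AX, Some AY, Some AZ}" "m' \<in> {None, Some AX, Some AY, Some AZ}"
    using UNIV_axis_option by auto
  then show ?thesis
    by (auto simp: UNIV_axis UNIV_outcome qubit_entry_def)
qed

lemma gram_measurement_matrix:
  fixes b b' :: "'n::finite \<Rightarrow> axis option"
  shows "(transpose measurement_matrix ** measurement_matrix) $ b $ b' =
    (if b = b' then 3 ^ num_identities b * 2 ^ CARD('n) else 0)"
proof -
  have "(transpose measurement_matrix ** measurement_matrix) $ b $ b' =
      (\<Sum>(r, a)\<in>UNIV. measurement_matrix $ (r, a) $ b * measurement_matrix $ (r, a) $ b')"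
    by (simp add: matrix_matrix_mult_def transpose_def case_prod_unfold)
  also have "\<dots> = (\<Sum>r\<in>UNIV. \<Sum>a\<in>UNIV. \<Prod>j\<in>UNIV.
      qubit_entry (r j) (a j) (b j) * qubit_entry (r j) (a j) (b' j))"
    by (simp add: measurement_matrix_eq_prod prod.distrib sum.cartesian_product
        flip: UNIV_Times_UNIV)
  also have "\<dots> = (\<Prod>j\<in>UNIV. \<Sum>x\<in>UNIV. \<Sum>y\<in>UNIV. qubit_entry x y (b j) * qubit_entry x y (b' j))"
    by (subst sum_prod_fun, subst sum_prod_fun) simp
  also have "\<dots> = (\<Prod>j\<in>UNIV. 2 * of_bool (b j = b' j) * (if b j = None then 3 else 1))"
    by (simp only: qubit_gram)
  also have "\<dots> = (if b = b' then 3 ^ num_identities b * 2 ^ CARD('n) else 0)"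
  proof (cases "b = b'")
    case True
    have "(\<Prod>j\<in>UNIV. if b j = None then 3 else 1 :: real) = 3 ^ num_identities b"
      by (simp add: num_identities_def identity_positions_def prod.If_cases)
    with True show ?thesis
      by (simp add: prod.distrib)
  next
    case False
    then obtain j where "b j \<noteq> b' j"
      by auto
    then have "\<exists>j\<in>UNIV. 2 * of_bool (b j = b' j) * (if b j = None then 3 else 1) = (0 :: real)"
      by (intro bexI[of _ j]) simp_all
    with False show ?thesis
      by (simp only: if_False finite prod_zero)
  qed
  finally show ?thesis .
qed

lemma trace_tensor_mult:
  "trace (tensor A ** tensor B) = (\<Prod>j\<in>UNIV. trace (A j ** B j))"
proof -
  have "trace (tensor A ** tensor B) =
      (\<Sum>s\<in>UNIV. \<Sum>t\<in>UNIV. \<Prod>j\<in>UNIV. A j $ s j $ t j * B j $ t j $ s j)"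
    by (simp add: trace_def matrix_matrix_mult_def tensor_def prod.distrib)
  also have "\<dots> = (\<Prod>j\<in>UNIV. \<Sum>x\<in>UNIV. \<Sum>y\<in>UNIV. A j $ x $ y * B j $ y $ x)"
    by (subst sum_prod_fun, subst sum_prod_fun) simp
  finally show ?thesis
    by (simp add: trace_def matrix_matrix_mult_def)
qed

text \<open>
  The projector is half of the identity plus the signed Pauli matrix, and the trace form makes the
  four Pauli matrices orthogonal with squared norm 2: pairing with I sees only the first term,
  pairing with an axis only the second.
\<close>

lemma trace_pauli_axis_projector:
  "trace (pauli m ** axis_projector r a) = complex_of_real (qubit_entry r a m)"
proof -
  have proj: "axis_projector r a $ s $ t =
      (pauli None $ s $ t + of_real (outcome_val r) * pauli (Some a) $ s $ t) / 2" for s t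
    by (simp add: axis_projector_eq scaleR_conv_of_real[where 'a = complex])
  have "trace (pauli m ** axis_projector r a) =
      ((\<Sum>s\<in>UNIV. \<Sum>t\<in>UNIV. pauli m $ s $ t * pauli None $ t $ s) +
       of_real (outcome_val r) * (\<Sum>s\<in>UNIV. \<Sum>t\<in>UNIV. pauli m $ s $ t * pauli (Some a) $ t $ s)) / 2"
    by (simp add: trace_def matrix_matrix_mult_def proj sum_2 algebra_simps add_divide_distrib
        del: pauli.simps)
  also have "\<dots> = complex_of_real (qubit_entry r a m)"
    unfolding pauli_orthogonality by (cases m) (auto simp: qubit_entry_def)
  finally show ?thesis .
qed

lemma trace_pauli_string_outcome_projector:
  "trace (pauli_string b ** outcome_projector r a) =
    complex_of_real (measurement_matrix $ (r, a) $ b)"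
  by (simp add: pauli_string_def outcome_projector_def trace_tensor_mult
      trace_pauli_axis_projector measurement_matrix_eq_prod)

lemma trace_scaleR_sum_mult:
  fixes S :: "'b \<Rightarrow> complex ^ 'm ^ 'm" and B :: "complex ^ 'm ^ 'm"
  shows "trace ((\<Sum>i\<in>I. c i *\<^sub>R S i) ** B) = (\<Sum>i\<in>I. c i *\<^sub>R trace (S i ** B))"
proof -
  have lin: "linear (\<lambda>A. trace (A ** B))"
    by (rule linearI)
      (simp_all add: trace_def matrix_matrix_mult_def algebra_simps sum.distrib scaleR_sum_right)
  show ?thesis
    by (simp add: linear_sum[OF lin] linear_scale[OF lin])
qed

lemma measurement_matrix_pauli_coeffs:
  fixes \<rho> :: "'n::finite operator"
  assumes "hermitian \<rho>"
  shows "measurement_matrix *v pauli_coeffs \<rho> = outcome_probs \<rho>"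
proof -
  have expansion: "\<rho> = (\<Sum>b\<in>UNIV. (pauli_coeffs \<rho> $ b) *\<^sub>R pauli_string b)"
    unfolding pauli_coeffs_def by (rule theI'[OF pauli_decomposition_unique[OF assms]])
  have "outcome_probs \<rho> $ (r, a) = (measurement_matrix *v pauli_coeffs \<rho>) $ (r, a)" for r a
  proof -
    have "trace (\<rho> ** outcome_projector r a) =
        (\<Sum>b\<in>UNIV. (pauli_coeffs \<rho> $ b) *\<^sub>R trace (pauli_string b ** outcome_projector r a))"
      by (subst expansion) (rule trace_scaleR_sum_mult)
    then show ?thesis
      by (simp add: outcome_probs_def trace_pauli_string_outcome_projector
          matrix_vector_mult_def mult.commute)
  qed
  then show ?thesis
    by (simp add: vec_eq_iff split_paired_all)
qed

lemma invertible_diagonal: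
  fixes A :: "'a::field ^ 'm ^ 'm"
  assumes "\<And>i j. i \<noteq> j \<Longrightarrow> A $ i $ j = 0" and "\<And>i. A $ i $ i \<noteq> 0"
  shows "invertible A"
proof -
  have "det A = (\<Prod>i\<in>UNIV. A $ i $ i)"
    by (rule det_diagonal) (rule assms)
  with assms(2) show ?thesis
    by (simp add: invertible_det_nz)
qed

lemma least_squares_solution:
  fixes P :: "real ^ 'm ^ 'k"
  assumes "invertible (transpose P ** P)"
  shows "matrix_inv (transpose P ** P) *v (transpose P *v (P *v v)) = v"
proof -
  have "matrix_inv (transpose P ** P) ** (transpose P ** P) = mat 1"
    using someI_ex[OF assms[unfolded invertible_def]] by (simp add: matrix_inv_def)
  then show ?thesis
    by (simp add: matrix_vector_mul_assoc matrix_mul_assoc)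
qed

theorem proposition2:
  fixes \<rho> :: "'n::finite operator"
    and P :: "real ^ ('n \<Rightarrow> axis option) ^ (('n \<Rightarrow> outcome) \<times> ('n \<Rightarrow> axis))"
  assumes "density_matrix \<rho>"
    and "P = measurement_matrix"
  shows "(\<forall>b b'. b \<noteq> b' \<longrightarrow> (transpose P ** P) $ b $ b' = 0) \<and>
    (\<forall>b. (transpose P ** P) $ b $ b = 3 ^ num_identities b * 2 ^ CARD('n) \<and>
         (transpose P ** P) $ b $ b \<noteq> 0) \<and>
    inj (\<lambda>v. P *v v) \<and>
    (\<exists>!v. P *v v = outcome_probs \<rho>) \<and>
    P *v pauli_coeffs \<rho> = outcome_probs \<rho> \<and>
    invertible (transpose P ** P) \<and>
    pauli_coeffs \<rho> = matrix_inv (transpose P ** P) *v (transpose P *v outcome_probs \<rho>)"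
proof -
  have gram: "(transpose P ** P) $ b $ b' =
      (if b = b' then 3 ^ num_identities b * 2 ^ CARD('n) else 0)" for b b'
    unfolding assms(2) by (rule gram_measurement_matrix)
  have inv: "invertible (transpose P ** P)"
    by (rule invertible_diagonal) (simp_all add: gram)
  note solve = least_squares_solution[OF inv]
  have inj: "inj (\<lambda>v. P *v v)"
    by (rule inj_on_inverseI) (rule solve)
  have probs: "P *v pauli_coeffs \<rho> = outcome_probs \<rho>"
    using assms by (simp add: measurement_matrix_pauli_coeffs density_matrix_def)
  have "\<exists>!v. P *v v = outcome_probs \<rho>"
    using probs inj by (metis injD)
  moreover have "pauli_coeffs \<rho> = matrix_inv (transpose P ** P) *v (transpose P *v outcome_probs \<rho>)"
    using solve[of "pauli_coeffs \<rho>"] probs by simp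
  ultimately show ?thesis
    using inv inj probs by (simp add: gram)
qed

end
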